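(* Let $(X,d)$ be a metric space and let $\mathcal{G}$ be a group acting on $X$ such that for all $x_1,x_2\in X$ there exists $G\in\mathcal{G}$ with $$G(x_1)=x_2\quad\text{and}\quad d(x,G(x))\le d(x_1,x_2)\ \text{ for all }x\in X.$$ Let $F\subseteq\mathbf{R}^X$ be a $\mathcal{G}$-invariant vector space which contains the constants, and suppose that $\Phi:F\to F$ is a mapping which satisfies: 1) (monotonicity) $\Phi(f_1)\le\Phi(f_2)$ for all $f_1,f_2\in F$ with $f_1\le f_2$; 2) ($\mathcal{G}$-equivariance) $\Phi(G(f))=G(\Phi(f))$ for all $f\in F$ and all $G\in\mathcal{G}$; 3) (equivariance through constants) $\Phi(f+c)=\Phi(f)+c$ for all $f\in F$ and all $c\in\mathbf{R}$. Then, whenever $f\in F$ and $\omega$ is a modulus of continuity for $f$, $\omega$ is also a modulus of continuity for $\Phi(f)$.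
   Context: The action of $\mathcal{G}$ on $X$ induces an action on $\mathbf{R}^X$ (the set of all functions $X\to\mathbf{R}$) by $G(f)(x):=f(G^{-1}(x))$ for $f\in\mathbf{R}^X$, $x\in X$, where $G^{-1}$ is the inverse of $G$ in $\mathcal{G}$. Inequalities between functions are pointwise. A non-decreasing function $\omega:(0,+\infty)\to(0,+\infty)$ is a modulus of continuity for a function $f:X\to\mathbf{R}$ if and only if $|f(x_1)-f(x_2)|\le\omega(d(x_1,x_2))$ for all $x_1,x_2\in X$ with $x_1\neq x_2$. *)

theory Defs
  imports
    "HOL-Analysis.Analysis"
    "HOL-Algebra.Group_Action"
    "HOL-Library.Function_Algebras"
begin

definition fun_scale :: "real \<Rightarrow> ('x \<Rightarrow> real) \<Rightarrow> 'x \<Rightarrow> real" where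
  "fun_scale c f = (\<lambda>x. c * f x)"

(* Zero and addition of functions are the pointwise ones of Function_Algebras. *)
interpretation fun_vs: vector_space "fun_scale :: real \<Rightarrow> ('x \<Rightarrow> real) \<Rightarrow> 'x \<Rightarrow> real"
  by standard (auto simp: fun_scale_def fun_eq_iff algebra_simps)

(* For an action phi of G on X, this is the induced left action on real functions on X:
   precomposition with the action of the inverse group element. *)
definition fun_action ::
    "('g, 'b) monoid_scheme \<Rightarrow> ('g \<Rightarrow> 'x \<Rightarrow> 'x) \<Rightarrow> 'g \<Rightarrow> ('x \<Rightarrow> real) \<Rightarrow> 'x \<Rightarrow> real" where
  "fun_action G \<phi> g f = (\<lambda>x. f (\<phi> (inv\<^bsub>G\<^esub> g) x))"

(* omega is a function on the positive reals; its values elsewhere are junk and unconstrained. *)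
definition modulus_of_continuity :: "(real \<Rightarrow> real) \<Rightarrow> ('x::metric_space \<Rightarrow> real) \<Rightarrow> bool" where
  "modulus_of_continuity \<omega> f \<longleftrightarrow>
     \<omega> \<in> {0<..} \<rightarrow> {0<..} \<and> mono_on {0<..} \<omega> \<and>
     (\<forall>x1 x2. x1 \<noteq> x2 \<longrightarrow> \<bar>f x1 - f x2\<bar> \<le> \<omega> (dist x1 x2))"

end

theory Submission
  imports Defs
begin

text \<open>
  A modulus of continuity compares a function with its own translates. If \<open>g\<close> moves no point by
  more than \<open>r > 0\<close>, then \<open>g\<cdot>f \<le> f + \<omega> r\<close> pointwise, because the value of \<open>g\<cdot>f\<close> at \<open>x\<close> is the
  value of \<open>f\<close> at a point within distance \<open>r\<close> of \<open>x\<close> (lemma \<open>fun_action_le_add_modulus\<close>). Such an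
  inequality between functions is exactly what \<open>\<Phi>\<close> preserves: monotonicity and the two
  equivariances turn it into \<open>g\<cdot>\<Phi> f \<le> \<Phi> f + \<omega> r\<close>. Choosing \<open>g\<close> so that it carries \<open>x\<close> to \<open>y\<close> and
  moves no point by more than \<open>dist x y\<close>, and evaluating at \<open>y\<close>, gives
  \<open>\<Phi> f x \<le> \<Phi> f y + \<omega> (dist x y)\<close>; exchanging \<open>x\<close> and \<open>y\<close> bounds the absolute value.
\<close>

lemma group_action_inv_right:
  assumes "group_action G UNIV \<phi>" and "g \<in> carrier G"
  shows "\<phi> g (\<phi> (inv\<^bsub>G\<^esub> g) x) = x"
proof -
  interpret group_action G UNIV \<phi> by fact
  interpret group G using group_hom by (rule group_hom.axioms)
  have "\<phi> (inv\<^bsub>G\<^esub> (inv\<^bsub>G\<^esub> g)) (\<phi> (inv\<^bsub>G\<^esub> g) x) = x"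
    using assms(2) by (rule orbit_sym_aux[OF inv_closed]) simp_all
  then show ?thesis using assms(2) by simp
qed

lemma fun_action_image:
  assumes "group_action G UNIV \<phi>" and "g \<in> carrier G"
  shows "fun_action G \<phi> g h (\<phi> g x) = h x"
proof -
  interpret group_action G UNIV \<phi> by fact
  show ?thesis
    using orbit_sym_aux[OF assms(2), of x "\<phi> g x"] by (simp add: fun_action_def)
qed

text \<open>
  Monotonicity of \<open>\<omega>\<close> enters here: the displacement varies from point to point and is known
  only to be at most \<open>r\<close>. Positivity of \<open>\<omega>\<close> takes care of the fixed points of \<open>g\<close>, at which
  the modulus says nothing.
\<close>

lemma fun_action_le_add_modulus:
  fixes \<phi> :: "'g \<Rightarrow> 'x::metric_space \<Rightarrow> 'x"
  assumes action: "group_action G UNIV \<phi>" and g: "g \<in> carrier G"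
    and modulus: "modulus_of_continuity \<omega> f"
    and r: "0 < r" and displacement: "\<And>x. dist x (\<phi> g x) \<le> r"
  shows "fun_action G \<phi> g f \<le> f + (\<lambda>_. \<omega> r)"
proof (rule le_funI)
  fix x
  define y where "y = \<phi> (inv\<^bsub>G\<^esub> g) x"
  have x: "x = \<phi> g y"
    using group_action_inv_right[OF action g] by (simp add: y_def)
  have "f y \<le> f x + \<omega> r"
  proof (cases "y = x")
    case True
    have "0 < \<omega> r"
      using modulus r by (auto simp: modulus_of_continuity_def)
    with True show ?thesis by simp
  next
    case False
    have "\<bar>f y - f x\<bar> \<le> \<omega> (dist y x)"
      using modulus False by (simp add: modulus_of_continuity_def)
    also have "\<dots> \<le> \<omega> r"
      using modulus False r displacement[of y] x
      by (auto simp: modulus_of_continuity_def intro: mono_onD)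
    finally show ?thesis by simp
  qed
  then show "fun_action G \<phi> g f x \<le> (f + (\<lambda>_. \<omega> r)) x"
    by (simp add: fun_action_def y_def)
qed

theorem lemma2p8:
  fixes G :: "('g, 'b) monoid_scheme"
    and \<phi> :: "'g \<Rightarrow> 'x::metric_space \<Rightarrow> 'x"
    and F :: "('x \<Rightarrow> real) set"
    and \<Phi> :: "('x \<Rightarrow> real) \<Rightarrow> ('x \<Rightarrow> real)"
    and f :: "'x \<Rightarrow> real"
    and \<omega> :: "real \<Rightarrow> real"
  assumes action: "group_action G UNIV \<phi>"
    and small_transitive:
      "\<And>x1 x2. \<exists>g\<in>carrier G. \<phi> g x1 = x2 \<and> (\<forall>x. dist x (\<phi> g x) \<le> dist x1 x2)"
    and subspace: "fun_vs.subspace F"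
    and invariant: "\<And>g h. g \<in> carrier G \<Longrightarrow> h \<in> F \<Longrightarrow> fun_action G \<phi> g h \<in> F"
    and constants: "\<And>c. (\<lambda>_. c) \<in> F"
    and maps: "\<Phi> \<in> F \<rightarrow> F"
    and monotone: "\<And>f1 f2. f1 \<in> F \<Longrightarrow> f2 \<in> F \<Longrightarrow> f1 \<le> f2 \<Longrightarrow> \<Phi> f1 \<le> \<Phi> f2"
    and equivariant:
      "\<And>g h. g \<in> carrier G \<Longrightarrow> h \<in> F \<Longrightarrow> \<Phi> (fun_action G \<phi> g h) = fun_action G \<phi> g (\<Phi> h)"
    and const_equivariant:
      "\<And>h c. h \<in> F \<Longrightarrow> \<Phi> (h + (\<lambda>_. c)) = \<Phi> h + (\<lambda>_. c)"
    and "f \<in> F"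
    and "modulus_of_continuity \<omega> f"
  shows "modulus_of_continuity \<omega> (\<Phi> f)"
proof -
  have one_sided: "\<Phi> f x \<le> \<Phi> f y + \<omega> (dist x y)" if "x \<noteq> y" for x y
  proof -
    obtain g where g: "g \<in> carrier G" and gx: "\<phi> g x = y"
      and displacement: "\<And>z. dist z (\<phi> g z) \<le> dist x y"
      using small_transitive by blast
    let ?c = "\<lambda>_::'x. \<omega> (dist x y)"
    have "fun_action G \<phi> g f \<le> f + ?c"
      using that
      by (intro fun_action_le_add_modulus[OF action g \<open>modulus_of_continuity \<omega> f\<close> _ displacement])
        simp
    moreover have "f + ?c \<in> F"
      using subspace \<open>f \<in> F\<close> constants by (rule fun_vs.subspace_add)
    ultimately have "\<Phi> (fun_action G \<phi> g f) \<le> \<Phi> (f + ?c)"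
      by (intro monotone invariant g \<open>f \<in> F\<close>)
    then have "fun_action G \<phi> g (\<Phi> f) \<le> \<Phi> f + ?c"
      by (simp only: equivariant[OF g \<open>f \<in> F\<close>] const_equivariant[OF \<open>f \<in> F\<close>])
    then have "fun_action G \<phi> g (\<Phi> f) y \<le> \<Phi> f y + \<omega> (dist x y)"
      by (simp add: le_fun_def)
    then show ?thesis
      using fun_action_image[OF action g, of "\<Phi> f" x] gx by simp
  qed
  have "\<bar>\<Phi> f x - \<Phi> f y\<bar> \<le> \<omega> (dist x y)" if "x \<noteq> y" for x y
    using one_sided[of x y] one_sided[of y x] that by (simp add: dist_commute abs_le_iff)
  then show ?thesis
    using \<open>modulus_of_continuity \<omega> f\<close> by (simp add: modulus_of_continuity_def)
qed

end
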